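(* For all integers $n\ge 2$, $eq_n=UT_n$, where $eq_n$ is the number of parking functions $(a_1,\dots,a_n)$ of length $n$ with $a_1=a_2$, and $UT_n$ is the number of edge-labelled trees with label set $\{1,2,\dots,n\}$ on $n+1$ unlabelled vertices.
   Context: A parking function of length $n$ is a sequence $(a_1,\dots,a_n)$ of integers in $\{0,1,\dots,n-1\}$ whose weakly increasing rearrangement $(b_1,\dots,b_n)$ satisfies $b_i<i$ for all $i$. An edge-labelled tree with label set $\{1,\dots,n\}$ on $n+1$ unlabelled vertices is a tree with $n+1$ vertices whose $n$ edges are labelled bijectively by $\{1,\dots,n\}$, counted up to isomorphisms of trees that preserve the edge labels. *)

theory Defs
  imports Main
begin

(* The list index is shifted by one against the mathematical index: b_i is sort a ! (i - 1). *)
definition parking_function :: "nat \<Rightarrow> nat list \<Rightarrow> bool" where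
  "parking_function n a \<longleftrightarrow>
     length a = n \<and> set a \<subseteq> {0..<n} \<and> (\<forall>i\<in>{1..n}. sort a ! (i - 1) < i)"

definition eq_parking :: "nat \<Rightarrow> nat" where
  "eq_parking n = card {a. parking_function n a \<and> a ! 0 = a ! 1}"

definition simple_graph :: "'v set \<Rightarrow> 'v set set \<Rightarrow> bool" where
  "simple_graph V E \<longleftrightarrow> finite V \<and> (\<forall>e\<in>E. e \<subseteq> V \<and> card e = 2)"

definition connected_graph :: "'v set \<Rightarrow> 'v set set \<Rightarrow> bool" where
  "connected_graph V E \<longleftrightarrow> V \<noteq> {} \<and> (\<forall>u\<in>V. \<forall>v\<in>V. (u, v) \<in> {(x, y). {x, y} \<in> E}\<^sup>*)"

(* The list of the distinct vertices of a cycle; its last vertex is adjacent to its first. *)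
definition is_cycle :: "'v set set \<Rightarrow> 'v list \<Rightarrow> bool" where
  "is_cycle E c \<longleftrightarrow>
     length c \<ge> 3 \<and> distinct c \<and>
     (\<forall>i<length c. {c ! i, c ! (Suc i mod length c)} \<in> E)"

definition is_tree :: "'v set \<Rightarrow> 'v set set \<Rightarrow> bool" where
  "is_tree V E \<longleftrightarrow> simple_graph V E \<and> connected_graph V E \<and> \<not> (\<exists>c. is_cycle E c)"

(* Vertices, edges and edge labelling. Only the values of the labelling on the edges matter. *)
type_synonym 'v labelled_graph = "'v set \<times> 'v set set \<times> ('v set \<Rightarrow> nat)"

definition edge_labelled_tree :: "nat \<Rightarrow> 'v labelled_graph \<Rightarrow> bool" where
  "edge_labelled_tree n = (\<lambda>(V, E, L). is_tree V E \<and> card V = n + 1 \<and> bij_betw L E {1..n})"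

definition label_iso :: "'v labelled_graph \<Rightarrow> 'v labelled_graph \<Rightarrow> bool" where
  "label_iso = (\<lambda>(V, E, L) (V', E', L').
     \<exists>f. bij_betw f V V' \<and>
         (\<forall>u\<in>V. \<forall>v\<in>V. {u, v} \<in> E \<longleftrightarrow> {f u, f v} \<in> E') \<and>
         (\<forall>e\<in>E. L' (f ` e) = L e))"

definition label_iso_rel :: "nat \<Rightarrow> ('v labelled_graph \<times> 'v labelled_graph) set" where
  "label_iso_rel n =
     {(S, T). edge_labelled_tree n S \<and> edge_labelled_tree n T \<and> label_iso S T}"

(* The vertices are arbitrary natural numbers, so every isomorphism type of trees occurs.
   The count is of isomorphism classes, which is why the vertices are unlabelled. *)
definition UT :: "nat \<Rightarrow> nat" where
  "UT n = card ({T :: nat labelled_graph. edge_labelled_tree n T} // label_iso_rel n)"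

lemma label_iso_refl: "label_iso S S"
  by (cases S) (auto simp: label_iso_def intro!: exI[of _ id])

lemma edge_pairE:
  assumes "edge_labelled_tree n (V, E, L)" "e \<in> E"
  obtains u v where "e = {u, v}" "u \<in> V" "v \<in> V"
  using assms
  by (fastforce simp: edge_labelled_tree_def is_tree_def simple_graph_def card_2_iff)

lemma label_iso_sym:
  assumes S: "edge_labelled_tree n S" and T: "edge_labelled_tree n T" and iso: "label_iso S T"
  shows "label_iso T S"
proof -
  obtain V E L where S': "S = (V, E, L)" by (cases S)
  obtain V' E' L' where T': "T = (V', E', L')" by (cases T)
  from iso obtain f where f: "bij_betw f V V'"
    and adj: "\<And>u v. u \<in> V \<Longrightarrow> v \<in> V \<Longrightarrow> {u, v} \<in> E \<longleftrightarrow> {f u, f v} \<in> E'"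
    and lab: "\<And>e. e \<in> E \<Longrightarrow> L' (f ` e) = L e"
    by (auto simp: label_iso_def S' T')
  define g where "g = inv_into V f"
  have g: "bij_betw g V' V" unfolding g_def by (rule bij_betw_inv_into[OF f])
  have gV: "g x \<in> V" if "x \<in> V'" for x using g that by (auto simp: bij_betw_def)
  have fg: "f (g x) = x" if "x \<in> V'" for x
    unfolding g_def using f that by (rule bij_betw_inv_into_right)
  have adj': "{u, v} \<in> E' \<longleftrightarrow> {g u, g v} \<in> E" if "u \<in> V'" "v \<in> V'" for u v
    using adj[of "g u" "g v"] gV fg that by simp
  have lab': "L (g ` e) = L' e" if e: "e \<in> E'" for e
  proof -
    obtain u v where uv: "e = {u, v}" "u \<in> V'" "v \<in> V'"
      using edge_pairE[OF T[unfolded T'] e] .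
    then have "g ` e \<in> E" using adj'[of u v] e by simp
    from lab[OF this] show ?thesis using uv fg by simp
  qed
  show ?thesis unfolding S' T' label_iso_def using g adj' lab' by auto
qed

lemma label_iso_trans:
  assumes S: "edge_labelled_tree n S"
    and iso: "label_iso S T" and iso': "label_iso T U"
  shows "label_iso S U"
proof -
  obtain V E L where S': "S = (V, E, L)" by (cases S)
  obtain V' E' L' where T': "T = (V', E', L')" by (cases T)
  obtain V'' E'' L'' where U': "U = (V'', E'', L'')" by (cases U)
  from iso obtain f where f: "bij_betw f V V'"
    and adj: "\<And>u v. u \<in> V \<Longrightarrow> v \<in> V \<Longrightarrow> {u, v} \<in> E \<longleftrightarrow> {f u, f v} \<in> E'"
    and lab: "\<And>e. e \<in> E \<Longrightarrow> L' (f ` e) = L e"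
    by (auto simp: label_iso_def S' T')
  from iso' obtain g where g: "bij_betw g V' V''"
    and adj': "\<And>u v. u \<in> V' \<Longrightarrow> v \<in> V' \<Longrightarrow> {u, v} \<in> E' \<longleftrightarrow> {g u, g v} \<in> E''"
    and lab': "\<And>e. e \<in> E' \<Longrightarrow> L'' (g ` e) = L' e"
    by (auto simp: label_iso_def U' T')
  have fV: "f x \<in> V'" if "x \<in> V" for x using f that by (auto simp: bij_betw_def)
  have 1: "bij_betw (g \<circ> f) V V''" using f g by (rule bij_betw_trans)
  have 2: "{u, v} \<in> E \<longleftrightarrow> {(g \<circ> f) u, (g \<circ> f) v} \<in> E''" if "u \<in> V" "v \<in> V" for u v
    using adj[OF that] adj'[of "f u" "f v"] fV that by simp
  have 3: "L'' ((g \<circ> f) ` e) = L e" if e: "e \<in> E" for e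
  proof -
    obtain u v where uv: "e = {u, v}" "u \<in> V" "v \<in> V"
      using edge_pairE[OF S[unfolded S'] e] .
    then have "f ` e \<in> E'" using adj[of u v] e by simp
    then show ?thesis using lab[OF e] lab'[of "f ` e"] by (simp add: image_comp)
  qed
  show ?thesis unfolding S' U' label_iso_def using 1 2 3 by blast
qed

lemma equiv_label_iso_rel: "equiv {T. edge_labelled_tree n T} (label_iso_rel n)"
proof (rule equivI)
  show "label_iso_rel n \<subseteq> {T. edge_labelled_tree n T} \<times> {T. edge_labelled_tree n T}"
    by (auto simp: label_iso_rel_def)
  show "refl_on {T. edge_labelled_tree n T} (label_iso_rel n)"
    by (auto simp: refl_on_def label_iso_rel_def label_iso_refl)
  show "sym (label_iso_rel n)"
    by (auto simp: label_iso_rel_def intro!: symI dest: label_iso_sym)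
  show "trans (label_iso_rel n)"
    by (auto simp: label_iso_rel_def intro!: transI intro: label_iso_trans)
qed

end

theory Submission
  imports Defs "HOL-Library.FuncSet"
begin

text \<open>Both numbers are \<open>(n + 1) ^ (n - 2)\<close>. On the parking side, the group of integers modulo
  \<open>n + 1\<close> acts by translation on the sequences with \<open>a\<^sub>1 = a\<^sub>2\<close>, and by the cycle lemma every orbit
  contains exactly one parking function (Pollak's argument). On the tree side, choosing a root and
  pushing every edge label to the endpoint away from the root turns an edge-labelled tree into an
  acyclic parent function on \<open>{1..n}\<close> with root \<open>0\<close>. For \<open>n \<ge> 2\<close> a tree has no nontrivial
  label-preserving automorphism, so every isomorphism class arises from exactly \<open>n + 1\<close> of the
  \<open>(n + 1) ^ (n - 1)\<close> parent functions.\<close>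

section \<open>Parking functions\<close>

lemma sorted_nth_less_iff:
  fixes xs :: "nat list"
  assumes "sorted xs" "k < length xs"
  shows "xs ! k < m \<longleftrightarrow> k < length (filter (\<lambda>x. x < m) xs)"
  using assms
proof (induction xs arbitrary: k)
  case Nil
  then show ?case by simp
next
  case (Cons x xs)
  show ?case
  proof (cases "x < m")
    case True
    then show ?thesis using Cons by (cases k) auto
  next
    case False
    then have "filter (\<lambda>x. x < m) xs = []" using Cons.prems by (auto simp: filter_empty_conv)
    moreover have "x \<le> (x # xs) ! k" using Cons.prems by (cases k) auto
    ultimately show ?thesis using False by auto
  qed
qed

lemma length_filter_less_eq_sum_count:
  fixes xs :: "nat list"
  shows "length (filter (\<lambda>x. x < m) xs) = (\<Sum>v<m. count_list xs v)"
proof (induction xs)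
  case Nil
  then show ?case by simp
next
  case (Cons x xs)
  have "count_list (x # xs) v = (if x = v then 1 else 0) + count_list xs v" for v by simp
  then show ?case using Cons by (simp add: sum.distrib sum.delta del: count_list.simps)
qed

lemma length_filter_sort: "length (filter P (sort xs)) = length (filter P xs)"
  by (metis filter_sort length_sort)

lemma parking_function_iff_count:
  assumes "length b = n" "set b \<subseteq> {0..n}"
  shows "parking_function n b \<longleftrightarrow> (\<forall>i\<in>{1..n}. i \<le> (\<Sum>v<i. count_list b v))"
proof -
  have nth: "sort b ! (i - 1) < i \<longleftrightarrow> i \<le> (\<Sum>v<i. count_list b v)" if "i \<in> {1..n}" for i
  proof -
    have "sort b ! (i - 1) < i \<longleftrightarrow> i - 1 < length (filter (\<lambda>x. x < i) (sort b))"
      using that assms by (intro sorted_nth_less_iff) auto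
    also have "length (filter (\<lambda>x. x < i) (sort b)) = (\<Sum>v<i. count_list b v)"
      unfolding length_filter_sort by (rule length_filter_less_eq_sum_count)
    finally show ?thesis using that by auto
  qed
  have "set b \<subseteq> {0..<n}" if "\<forall>i\<in>{1..n}. i \<le> (\<Sum>v<i. count_list b v)"
  proof (cases "n = 0")
    case True
    then show ?thesis using assms by simp
  next
    case False
    then have "length b \<le> length (filter (\<lambda>x. x < n) b)"
      using that assms by (simp add: length_filter_less_eq_sum_count)
    then have "\<forall>x\<in>set b. x < n"
      using length_filter_less[of _ b "\<lambda>x. x < n"] by fastforce
    then show ?thesis by auto
  qed
  then show ?thesis using nth assms by (auto simp: parking_function_def)
qed

text \<open>The witness is the leftmost minimum of \<open>S\<close> within one period. If
  \<open>c < c'\<close> both qualified, then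
  \<open>S c \<le> S c' \<le> S (c + N) = S c - 1\<close>.\<close>

lemma cycle_lemma:
  fixes S :: "nat \<Rightarrow> int"
  assumes N: "N > 0" and per: "\<And>k. S (k + N) = S k - 1"
  shows "\<exists>!c. c < N \<and> (\<forall>i<N. S c \<le> S (c + i))"
proof (rule ex_ex1I)
  define P where "P c \<longleftrightarrow> c < N \<and> (\<forall>k<N. S c \<le> S k)" for c
  have "\<exists>c. P c"
  proof -
    have "Min (S ` {..<N}) \<in> S ` {..<N}" using N by (intro Min_in) auto
    then obtain c where "c < N" "S c = Min (S ` {..<N})" by auto
    then have "P c" unfolding P_def by simp
    then show ?thesis ..
  qed
  define c where "c = (LEAST c. P c)"
  have c: "P c" unfolding c_def using \<open>\<exists>c. P c\<close> by (rule LeastI_ex)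
  have less: "S c < S k" if "k < c" for k
  proof -
    have "\<not> P k" using that unfolding c_def by (rule not_less_Least)
    then show ?thesis using c that unfolding P_def by (meson less_le_trans linorder_not_le order_less_trans)
  qed
  have "S c \<le> S (c + i)" if "i < N" for i
  proof (cases "c + i < N")
    case True
    then show ?thesis using c unfolding P_def by simp
  next
    case False
    \<comment> \<open>After wrapping around, \<open>S\<close> has dropped by 1. This is harmless,
      since values left of the leftmost minimum exceed it by at least 1.\<close>
    define k where "k = c + i - N"
    have "c + i = k + N" "k < c" using False that unfolding k_def by auto
    then show ?thesis using per[of k] less[of k] by simp
  qed
  then show "\<exists>c. c < N \<and> (\<forall>i<N. S c \<le> S (c + i))" using c unfolding P_def by blast
next
  have False if "c < c'" "c' < N" "\<forall>i<N. S c \<le> S (c + i)" "\<forall>i<N. S c' \<le> S (c' + i)" for c c'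
  proof -
    have "S c \<le> S c'" using that(3)[rule_format, of "c' - c"] that by simp
    moreover have "S c' \<le> S (c + N)" using that(4)[rule_format, of "N - c' + c"] that
      by (simp add: add.commute)
    ultimately show False using per[of c] by simp
  qed
  then show "c = c'" if "c < N \<and> (\<forall>i<N. S c \<le> S (c + i))" "c' < N \<and> (\<forall>i<N. S c' \<le> S (c' + i))"
    for c c' using that by (meson linorder_neqE_nat)
qed

section \<open>Translations modulo \<open>n + 1\<close> and Pollak's argument\<close>

definition unshift :: "nat \<Rightarrow> nat \<Rightarrow> nat list \<Rightarrow> nat list" where
  "unshift N c = map (\<lambda>x. (x + N - c) mod N)"

lemma mod_unshift_eq_iff:
  fixes x v c N :: nat
  assumes "x < N" "c < N" "v < N"
  shows "(x + N - c) mod N = v \<longleftrightarrow> x = (v + c) mod N"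
proof -
  have "(x + N - c) mod N = (if c \<le> x then x - c else x + N - c)"
    using assms by (auto simp: le_mod_geq)
  moreover have "(v + c) mod N = (if v + c < N then v + c else v + c - N)"
    using assms by (auto simp: le_mod_geq)
  ultimately show ?thesis using assms by auto
qed

lemma count_list_unshift:
  assumes "set a \<subseteq> {..<N}" "c < N" "v < N"
  shows "count_list (unshift N c a) v = count_list a ((v + c) mod N)"
  using assms by (induction a) (auto simp: unshift_def mod_unshift_eq_iff)

lemma sum_mod_period:
  fixes f :: "nat \<Rightarrow> 'a::comm_monoid_add"
  assumes "N > 0"
  shows "(\<Sum>v<N. f ((v + c) mod N)) = (\<Sum>v<N. f v)"
proof (rule sum.reindex_bij_betw)
  have "inj_on (\<lambda>v. (v + c) mod N) {..<N}"
  proof (rule inj_onI)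
    fix v w assume vw: "v \<in> {..<N}" "w \<in> {..<N}" "(v + c) mod N = (w + c) mod N"
    \<comment> \<open>Translating back is a left inverse; \<open>c\<close> is reduced first because
      \<open>mod_unshift_eq_iff\<close> asks for a shift below \<open>N\<close>.\<close>
    have inv: "((u + c mod N) mod N + N - c mod N) mod N = u" if "u < N" for u
      using mod_unshift_eq_iff[of "(u + c mod N) mod N" N "c mod N" u] that assms by auto
    have eq: "(v + c mod N) mod N = (w + c mod N) mod N" using vw(3) by (simp only: mod_add_right_eq)
    have "v = ((v + c mod N) mod N + N - c mod N) mod N" using inv[of v] vw(1) by auto
    also have "\<dots> = w" unfolding eq using inv[of w] vw(2) by auto
    finally show "v = w" .
  qed
  moreover from this have "(\<lambda>v. (v + c) mod N) ` {..<N} = {..<N}"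
    using assms by (intro endo_inj_surj) auto
  ultimately show "bij_betw (\<lambda>v. (v + c) mod N) {..<N} {..<N}"
    unfolding bij_betw_def ..
qed

lemma sum_count_list:
  fixes N :: nat
  assumes "set a \<subseteq> {..<N}"
  shows "(\<Sum>v<N. count_list a v) = length a"
proof -
  have "filter (\<lambda>x. x < N) a = a" using assms by (auto simp: filter_id_conv)
  then show ?thesis using length_filter_less_eq_sum_count[of N a] by simp
qed

text \<open>The walk \<open>S\<close> gains at each step the multiplicity of the current residue and
  loses 1, so over a full period it changes by \<open>n - (n + 1) = -1\<close>. Translating by
  \<open>c\<close> starts the walk at \<open>c\<close>, and the parking condition says that it stays
  at or above its starting height for \<open>n\<close> steps.\<close>

lemma ex1_parking_unshift:
  assumes a: "length a = n" "set a \<subseteq> {0..n}"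
  shows "\<exists>!c. c < n + 1 \<and> parking_function n (unshift (n + 1) c a)"
proof -
  define N where "N = n + 1"
  define S :: "nat \<Rightarrow> int" where "S k = (\<Sum>v<k. int (count_list a (v mod N)) - 1)" for k
  have aN: "set a \<subseteq> {..<N}" using a unfolding N_def by auto
  have N: "N > 0" unfolding N_def by simp
  have split: "S (c + i) = S c + (\<Sum>v<i. int (count_list a ((v + c) mod N)) - 1)" for c i
    unfolding S_def by (induction i) (auto simp: add.commute)
  have per: "S (k + N) = S k - 1" for k
  proof -
    have "(\<Sum>v<N. int (count_list a ((v + k) mod N))) = (\<Sum>v<N. int (count_list a v))"
      by (rule sum_mod_period[OF N])
    also have "\<dots> = int n" using sum_count_list[OF aN] a by (metis of_nat_sum)
    finally show ?thesis unfolding split by (simp add: sum_subtractf N_def)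
  qed
  have iff: "parking_function n (unshift N c a) \<longleftrightarrow> (\<forall>i<N. S c \<le> S (c + i))" if c: "c < N" for c
  proof -
    have step: "S c \<le> S (c + i) \<longleftrightarrow> i \<le> (\<Sum>v<i. count_list (unshift N c a) v)" if "i < N" for i
    proof -
      have "(\<Sum>v<i. count_list (unshift N c a) v) = (\<Sum>v<i. count_list a ((v + c) mod N))"
        using that c aN by (intro sum.cong) (auto simp: count_list_unshift)
      then show ?thesis unfolding split
        by (simp add: sum_subtractf flip: of_nat_sum)
    qed
    have "parking_function n (unshift N c a) \<longleftrightarrow>
        (\<forall>i\<in>{1..n}. i \<le> (\<Sum>v<i. count_list (unshift N c a) v))"
      using a N by (intro parking_function_iff_count) (auto simp: unshift_def N_def less_Suc_eq_le[symmetric])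
    \<comment> \<open>Only the trivial case \<open>i = 0\<close> is added, to match the window of
      the cycle lemma.\<close>
    also have "\<dots> \<longleftrightarrow> (\<forall>i<N. i \<le> (\<Sum>v<i. count_list (unshift N c a) v))"
    proof (intro iffI allI ballI impI)
      fix i assume le: "\<forall>i\<in>{1..n}. i \<le> (\<Sum>v<i. count_list (unshift N c a) v)" and "i < N"
      then show "i \<le> (\<Sum>v<i. count_list (unshift N c a) v)"
        by (cases "i = 0") (simp, rule bspec[OF le], simp add: N_def)
    qed (simp add: N_def)
    also have "\<dots> \<longleftrightarrow> (\<forall>i<N. S c \<le> S (c + i))" by (simp add: step cong: imp_cong)
    finally show ?thesis .
  qed
  show ?thesis
    using cycle_lemma[of N S, OF N per] unfolding N_def[symmetric] by (simp add: iff cong: conj_cong)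
qed

text \<open>Dropping the first entry loses nothing, as it repeats the second, and leaves an
  arbitrary list of length \<open>n - 1\<close>.\<close>

lemma card_lists_first_two_equal:
  assumes "n \<ge> 2" "finite A"
  shows "card {a. length a = n \<and> set a \<subseteq> A \<and> a ! 0 = a ! 1} = card A ^ (n - 1)"
proof -
  have "bij_betw tl {a. length a = n \<and> set a \<subseteq> A \<and> a ! 0 = a ! 1} {b. set b \<subseteq> A \<and> length b = n - 1}"
  proof (rule bij_betw_byWitness[where f' = "\<lambda>b. hd b # b"])
    show "\<forall>a\<in>{a. length a = n \<and> set a \<subseteq> A \<and> a ! 0 = a ! 1}. hd (tl a) # tl a = a"
    proof safe
      fix a :: "'a list" assume "n = length a" "a ! 0 = a ! 1"
      then show "hd (tl a) # tl a = a"
        using assms by (cases a; cases "tl a") auto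
    qed
    show "tl ` {a. length a = n \<and> set a \<subseteq> A \<and> a ! 0 = a ! 1} \<subseteq> {b. set b \<subseteq> A \<and> length b = n - 1}"
    proof safe
      fix a :: "'a list" and x assume "set a \<subseteq> A" "x \<in> set (tl a)"
      then show "x \<in> A" by (cases a) auto
    qed auto
    show "(\<lambda>b. hd b # b) ` {b. set b \<subseteq> A \<and> length b = n - 1} \<subseteq>
        {a. length a = n \<and> set a \<subseteq> A \<and> a ! 0 = a ! 1}"
    proof safe
      fix b :: "'a list" assume b: "length b = n - 1" "set b \<subseteq> A"
      then have "b \<noteq> []" using assms by auto
      then show "length (hd b # b) = n" "(hd b # b) ! 0 = (hd b # b) ! 1"
        using assms b by (auto simp: hd_conv_nth)
      show "x \<in> A" if "x \<in> set (hd b # b)" for x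
        using that b \<open>b \<noteq> []\<close> by auto
    qed
  qed auto
  then show ?thesis using assms by (simp add: bij_betw_same_card card_lists_length_eq)
qed

text \<open>By the cycle lemma the sets \<open>B c\<close> partition \<open>A\<close> into
  \<open>n + 1\<close> blocks. Translation keeps the first two entries equal, so each block is in
  bijection with the parking functions being counted.\<close>

lemma eq_parking_mult:
  assumes n: "n \<ge> 2"
  shows "(n + 1) * eq_parking n = (n + 1) ^ (n - 1)"
proof -
  define A where "A = {a. length a = n \<and> set a \<subseteq> {0..n} \<and> a ! 0 = a ! 1}"
  define B where "B c = {a \<in> A. parking_function n (unshift (n + 1) c a)}" for c
  have cardA: "card A = (n + 1) ^ (n - 1)"
    unfolding A_def using card_lists_first_two_equal[OF n, of "{0..n}"] by simp
  \<comment> \<open>An infinite set would have \<open>card\<close> zero, whereas this power is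
    positive.\<close>
  then have finA: "finite A" by (metis card.infinite power_not_zero add_is_0 one_neq_zero)
  have first_two: "map f a ! 0 = map f a ! 1" if "length a = n" "a ! 0 = a ! 1"
    for f :: "nat \<Rightarrow> nat" and a
    using that n by (cases a; cases "tl a") auto
  have "card (B c) = eq_parking n" if c: "c < n + 1" for c
  proof -
    have "bij_betw (unshift (n + 1) c) (B c) {a. parking_function n a \<and> a ! 0 = a ! 1}"
    proof (rule bij_betw_byWitness[where f' = "map (\<lambda>x. (x + c) mod (n + 1))"])
      have inv1: "((x + (n + 1) - c) mod (n + 1) + c) mod (n + 1) = x" if "x \<le> n" for x
        using mod_unshift_eq_iff[of x "n + 1" c "(x + (n + 1) - c) mod (n + 1)"] that c by auto
      have inv2: "((x + c) mod (n + 1) + (n + 1) - c) mod (n + 1) = x" if "x \<le> n" for x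
        using mod_unshift_eq_iff[of "(x + c) mod (n + 1)" "n + 1" c x] that c by auto
      show "\<forall>a\<in>B c. map (\<lambda>x. (x + c) mod (n + 1)) (unshift (n + 1) c a) = a"
        unfolding B_def A_def unshift_def using inv1 by (auto intro!: map_idI)
      have PF: "a \<in> A" if "parking_function n a" "a ! 0 = a ! 1" for a
        using that unfolding A_def parking_function_def by auto
      have id2: "unshift (n + 1) c (map (\<lambda>x. (x + c) mod (n + 1)) a) = a" if "a \<in> A" for a
        using that unfolding A_def unshift_def using inv2 by (auto intro!: map_idI)
      show "\<forall>a\<in>{a. parking_function n a \<and> a ! 0 = a ! 1}.
          unshift (n + 1) c (map (\<lambda>x. (x + c) mod (n + 1)) a) = a"
        using PF id2 by blast
      show "unshift (n + 1) c ` B c \<subseteq> {a. parking_function n a \<and> a ! 0 = a ! 1}"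
        using first_two unfolding B_def A_def by (auto simp: unshift_def)
      have "map (\<lambda>x. (x + c) mod (n + 1)) a \<in> A" if "a \<in> A" for a
        using first_two that unfolding A_def by (auto simp: less_Suc_eq_le[symmetric])
      then show "map (\<lambda>x. (x + c) mod (n + 1)) ` {a. parking_function n a \<and> a ! 0 = a ! 1} \<subseteq> B c"
        using PF id2 unfolding B_def by auto
    qed
    then show ?thesis unfolding eq_parking_def by (rule bij_betw_same_card)
  qed
  moreover have ex1: "\<exists>!c. c < n + 1 \<and> a \<in> B c" if "a \<in> A" for a
    using ex1_parking_unshift[of a n] that unfolding A_def B_def by simp
  have "A = (\<Union>c<n + 1. B c)"
  proof
    show "A \<subseteq> (\<Union>c<n + 1. B c)" using ex1 by fast
  qed (auto simp: B_def)
  moreover have "card (\<Union>c<n + 1. B c) = (\<Sum>c<n + 1. card (B c))"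
  proof (rule card_UN_disjoint)
    show "\<forall>i\<in>{..<n + 1}. \<forall>j\<in>{..<n + 1}. i \<noteq> j \<longrightarrow> B i \<inter> B j = {}"
    proof (intro ballI impI equals0I)
      fix i j a assume ij: "i \<in> {..<n + 1}" "j \<in> {..<n + 1}" "i \<noteq> j" and a: "a \<in> B i \<inter> B j"
      have "a \<in> A" using a by (simp add: B_def)
      moreover have "i < n + 1 \<and> a \<in> B i" "j < n + 1 \<and> a \<in> B j" using ij a by auto
      ultimately show False using ex1[of a] ij(3) by blast
    qed
  qed (auto simp: B_def finA)
  ultimately show ?thesis using cardA by simp
qed

section \<open>Counting rooted forests\<close>

text \<open>A rank function is a convenient way to say that every element of \<open>S\<close> reaches the set \<open>R\<close>
  of roots under iteration: a cycle inside \<open>S\<close> would make the rank decrease forever.\<close>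

definition rooted_forests :: "'a set \<Rightarrow> 'a set \<Rightarrow> ('a \<Rightarrow> 'a) set" where
  "rooted_forests S R = {p \<in> S \<rightarrow>\<^sub>E S \<union> R. \<exists>d :: 'a \<Rightarrow> nat. \<forall>i\<in>S. d (p i) < d i}"

lemma finite_rooted_forests: "finite S \<Longrightarrow> finite R \<Longrightarrow> finite (rooted_forests S R)"
  by (rule finite_subset[of _ "S \<rightarrow>\<^sub>E S \<union> R"]) (auto simp: rooted_forests_def intro: finite_PiE)

lemma rooted_forests_empty: "rooted_forests {} R = {\<lambda>x. undefined}"
  unfolding rooted_forests_def by auto

text \<open>An element of least rank would have a parent in \<open>S\<close> of still smaller
  rank.\<close>

lemma rooted_forests_no_roots:
  assumes "S \<noteq> {}"
  shows "rooted_forests S {} = {}"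
proof (rule equals0I)
  fix p assume "p \<in> rooted_forests S {}"
  then obtain d :: "'a \<Rightarrow> nat" where p: "p \<in> S \<rightarrow> S" and d: "\<forall>i\<in>S. d (p i) < d i"
    unfolding rooted_forests_def by (auto simp: PiE_def)
  obtain i where "i \<in> S" "\<forall>j\<in>S. d i \<le> d j"
    using assms arg_min_nat_le[of "\<lambda>x. x \<in> S" _ d] arg_min_natI[of "\<lambda>x. x \<in> S" _ d] by blast
  then show False using p d by (meson Pi_mem linorder_not_le)
qed

text \<open>This is the binomial theorem differentiated in \<open>r\<close> and multiplied by
  \<open>r\<close>. Combinatorially, \<open>card T\<close> counts a marked element \<open>y\<close>
  of \<open>T\<close>; after exchanging the sums, each \<open>y\<close> contributes a factor
  \<open>r\<close> and a binomial expansion over \<open>S - {y}\<close>.\<close>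

lemma sum_card_Pow_mult_power:
  fixes r x :: nat
  assumes "finite S"
  shows "(\<Sum>T\<in>Pow S. card T * r ^ card T * x ^ card (S - T)) = card S * r * (r + x) ^ (card S - 1)"
proof -
  have inner: "(\<Sum>T\<in>{T \<in> Pow S. y \<in> T}. r ^ card T * x ^ card (S - T)) = r * (r + x) ^ (card S - 1)"
    if y: "y \<in> S" for y
  proof -
    have "(\<Sum>T\<in>{T \<in> Pow S. y \<in> T}. r ^ card T * x ^ card (S - T)) =
        (\<Sum>T\<in>Pow (S - {y}). r * (r ^ card T * x ^ card (S - {y} - T)))"
    proof (rule sum.reindex_bij_witness[where i = "insert y" and j = "\<lambda>T. T - {y}"])
      fix T assume T: "T \<in> {T \<in> Pow S. y \<in> T}"
      then have "card T = Suc (card (T - {y}))"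
        using assms by (metis (no_types, lifting) card.remove finite_subset mem_Collect_eq PowD)
      moreover have "S - {y} - (T - {y}) = S - T" using T by auto
      ultimately show "r * (r ^ card (T - {y}) * x ^ card (S - {y} - (T - {y}))) = r ^ card T * x ^ card (S - T)"
        by simp
    qed (use y in auto)
    \<comment> \<open>Powers are written as constant products so that \<open>prod_add\<close>
      expands a product of sums over subsets.\<close>
    also have "\<dots> = r * (\<Sum>T\<in>Pow (S - {y}). (\<Prod>i\<in>T. r) * (\<Prod>i\<in>S - {y} - T. x))"
      by (simp add: sum_distrib_left)
    also have "\<dots> = r * (\<Prod>i\<in>S - {y}. r + x)"
      using assms by (subst prod_add) auto
    finally show ?thesis using assms y by simp
  qed
  have "(\<Sum>T\<in>Pow S. card T * r ^ card T * x ^ card (S - T)) =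
      (\<Sum>T\<in>Pow S. \<Sum>y\<in>{y \<in> S. y \<in> T}. r ^ card T * x ^ card (S - T))"
  proof (rule sum.cong[OF refl])
    fix T assume "T \<in> Pow S"
    then have "{y \<in> S. y \<in> T} = T" by auto
    then show "card T * r ^ card T * x ^ card (S - T) = (\<Sum>y\<in>{y \<in> S. y \<in> T}. r ^ card T * x ^ card (S - T))"
      by simp
  qed
  also have "\<dots> = (\<Sum>y\<in>S. \<Sum>T\<in>{T \<in> Pow S. y \<in> T}. r ^ card T * x ^ card (S - T))"
    using assms by (intro sum.swap_restrict) auto
  also have "\<dots> = card S * r * (r + x) ^ (card S - 1)" using inner by simp
  finally show ?thesis .
qed

text \<open>Cutting a forest below its roots: \<open>T\<close> is the set of children of the roots, and these become
  the roots of what remains.\<close>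

lemma card_rooted_forests_rec:
  assumes fin: "finite S" "finite R" and disj: "S \<inter> R = {}"
  shows "card (rooted_forests S R) =
    (\<Sum>T\<in>Pow S. card R ^ card T * card (rooted_forests (S - T) T))"
proof -
  define X where "X = (SIGMA T:Pow S. (T \<rightarrow>\<^sub>E R) \<times> rooted_forests (S - T) T)"
  define h where "h p = (let T = {i \<in> S. p i \<in> R} in (T, restrict p T, restrict p (S - T)))"
    for p :: "'a \<Rightarrow> 'a"
  define k where "k = (\<lambda>(T, f, q) (i :: 'a). if i \<in> T then f i else q i :: 'a)"
  have hX: "h p \<in> X" if p: "p \<in> rooted_forests S R" for p
  proof -
    obtain d :: "'a \<Rightarrow> nat" where d: "\<forall>i\<in>S. d (p i) < d i"
      using p unfolding rooted_forests_def by auto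
    define T where "T = {i \<in> S. p i \<in> R}"
    have "restrict p (S - T) \<in> (S - T) \<rightarrow>\<^sub>E (S - T) \<union> T"
      using p unfolding rooted_forests_def T_def restrict_PiE_iff by (auto simp: PiE_iff)
    moreover have "\<forall>i\<in>S - T. d (restrict p (S - T) i) < d i" using d by simp
    ultimately have "restrict p (S - T) \<in> rooted_forests (S - T) T"
      unfolding rooted_forests_def by blast
    moreover have "restrict p T \<in> T \<rightarrow>\<^sub>E R" unfolding restrict_PiE_iff T_def by simp
    moreover have "T \<in> Pow S" unfolding T_def by auto
    ultimately show ?thesis unfolding X_def h_def Let_def T_def[symmetric] by blast
  qed
  have kX: "k (T, f, q) \<in> rooted_forests S R \<and> h (k (T, f, q)) = (T, f, q)"
    if T: "T \<subseteq> S" and f: "f \<in> T \<rightarrow>\<^sub>E R" and q: "q \<in> rooted_forests (S - T) T" for T f q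
  proof
    obtain d :: "'a \<Rightarrow> nat" where d: "\<forall>i\<in>S - T. d (q i) < d i"
      using q unfolding rooted_forests_def by auto
    have qE: "q \<in> (S - T) \<rightarrow>\<^sub>E S" using q T unfolding rooted_forests_def by (auto simp: PiE_iff)
    \<comment> \<open>Nothing is known of \<open>d\<close> on \<open>R\<close>, so roots get rank 0
      and all other ranks are raised above it.\<close>
    let ?d = "\<lambda>i. if i \<in> R then 0 else Suc (d i)"
    have mem: "k (T, f, q) i \<in> (if i \<in> T then R else S)" if "i \<in> S" for i
      using that f qE unfolding k_def by (auto simp: PiE_iff)
    have "\<forall>i\<in>S. ?d (k (T, f, q) i) < ?d i"
    proof
      fix i assume i: "i \<in> S"
      then have "i \<notin> R" using disj by auto
      show "?d (k (T, f, q) i) < ?d i"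
      proof (cases "i \<in> T")
        case True
        then show ?thesis using mem[OF i] \<open>i \<notin> R\<close> by simp
      next
        case False
        then show ?thesis using d i \<open>i \<notin> R\<close> by (simp add: k_def)
      qed
    qed
    moreover have "k (T, f, q) \<in> S \<rightarrow>\<^sub>E S \<union> R"
    proof (rule PiE_I)
      show "k (T, f, q) i \<in> S \<union> R" if "i \<in> S" for i
        using mem[OF that] by (auto split: if_splits)
      show "k (T, f, q) i = undefined" if "i \<notin> S" for i
        using that T qE by (auto simp: k_def PiE_iff extensional_def)
    qed
    ultimately show "k (T, f, q) \<in> rooted_forests S R"
      unfolding rooted_forests_def by (intro CollectI conjI exI[of _ ?d])
    \<comment> \<open>\<open>T\<close> can be read off the glued function because the values on
      \<open>S - T\<close> lie in \<open>S\<close>, which is disjoint from \<open>R\<close>.\<close>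
    have TT: "{i \<in> S. k (T, f, q) i \<in> R} = T"
      using mem T disj by (fastforce split: if_splits)
    have "restrict (k (T, f, q)) T = f" using f by (auto simp: k_def restrict_def PiE_iff extensional_def)
    moreover have "restrict (k (T, f, q)) (S - T) = q"
      using qE by (auto simp: k_def restrict_def PiE_iff extensional_def)
    ultimately show "h (k (T, f, q)) = (T, f, q)" unfolding h_def Let_def TT by simp
  qed
  have kh: "k (h p) = p" if "p \<in> rooted_forests S R" for p
    using that unfolding rooted_forests_def h_def k_def
    by (auto simp: Let_def fun_eq_iff restrict_def PiE_iff extensional_def)
  have "bij_betw h (rooted_forests S R) X"
  proof (rule bij_betw_byWitness[where f' = k])
    show "h ` rooted_forests S R \<subseteq> X" using hX by blast
    show "\<forall>x\<in>X. h (k x) = x" "k ` X \<subseteq> rooted_forests S R"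
      using kX unfolding X_def by blast+
  qed (use kh in blast)
  then have "card (rooted_forests S R) = card X" by (rule bij_betw_same_card)
  also have "\<dots> = (\<Sum>T\<in>Pow S. card ((T \<rightarrow>\<^sub>E R) \<times> rooted_forests (S - T) T))"
    unfolding X_def using fin
    by (intro card_SigmaI) (auto intro!: finite_PiE finite_rooted_forests dest: finite_subset)
  also have "\<dots> = (\<Sum>T\<in>Pow S. card R ^ card T * card (rooted_forests (S - T) T))"
    using fin by (intro sum.cong) (auto simp: card_cartesian_product card_PiE dest: finite_subset)
  finally show ?thesis .
qed

text \<open>Multiplying by the number of vertices avoids the exponent \<open>card S - 1\<close>, which is
  truncated for empty \<open>S\<close>.\<close>

lemma card_rooted_forests:
  assumes "finite S" "finite R" "S \<inter> R = {}"
  shows "(card S + card R) * card (rooted_forests S R) = card R * (card S + card R) ^ card S"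
  using assms
proof (induction "card S" arbitrary: S R rule: less_induct)
  case less
  show ?case
  proof (cases "S = {}")
    case True
    then show ?thesis by (simp add: rooted_forests_empty)
  next
    case False
    then have s: "card S > 0" using less.prems by auto
    \<comment> \<open>The remaining forest has \<open>S\<close> as its full vertex set, whence the
      factor \<open>card S\<close>. Empty \<open>T\<close> is treated separately, since
      \<open>S - T\<close> is then not smaller; both sides vanish.\<close>
    have IH: "card S * card (rooted_forests (S - T) T) = card T * card S ^ card (S - T)"
      if "T \<subseteq> S" for T
    proof (cases "T = {}")
      case True
      then show ?thesis using False by (simp add: rooted_forests_no_roots)
    next
      case ne: False
      have fT: "finite T" using that less.prems finite_subset by auto
      have "card (S - T) + card T = card S"
        using that less.prems fT by (simp add: card_Diff_subset card_mono)
      moreover have "card T > 0" using ne fT by auto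
      ultimately show ?thesis
        using less.hyps[of "S - T" T] less.prems fT by auto
    qed
    have "card S * card (rooted_forests S R) =
        (\<Sum>T\<in>Pow S. card R ^ card T * (card S * card (rooted_forests (S - T) T)))"
      using less.prems by (simp add: card_rooted_forests_rec sum_distrib_left mult.left_commute)
    also have "\<dots> = (\<Sum>T\<in>Pow S. card T * card R ^ card T * card S ^ card (S - T))"
      by (intro sum.cong) (auto simp: IH)
    also have "\<dots> = card S * (card R * (card R + card S) ^ (card S - 1))"
      using less.prems by (simp add: sum_card_Pow_mult_power)
    finally have "card (rooted_forests S R) = card R * (card S + card R) ^ (card S - 1)"
      using s by (simp add: add.commute)
    then show ?thesis using s by (simp flip: power_Suc)
  qed
qed

section \<open>Edge-labelled trees\<close>

text \<open>A parent function on \<open>{1..n}\<close> with root \<open>0\<close> is read as a tree in which the edge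
  from \<open>i\<close> to its parent has label \<open>i\<close>.\<close>

definition parent_functions :: "nat \<Rightarrow> (nat \<Rightarrow> nat) set" where
  "parent_functions n = rooted_forests {1..n} {0}"

definition parent_tree :: "nat \<Rightarrow> (nat \<Rightarrow> nat) \<Rightarrow> nat labelled_graph" where
  "parent_tree n p =
     ({0..n}, (\<lambda>i. {i, p i}) ` {1..n}, inv_into {1..n} (\<lambda>i. {i, p i}))"

lemma finite_parent_functions: "finite (parent_functions n)"
  unfolding parent_functions_def by (intro finite_rooted_forests) auto

text \<open>Cayley's number of labelled trees on \<open>n + 1\<close> vertices, obtained here from
  forests with the single root \<open>0\<close>.\<close>

lemma card_parent_functions:
  assumes "n \<ge> 1"
  shows "card (parent_functions n) = (n + 1) ^ (n - 1)"
proof -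
  have "(n + 1) * card (parent_functions n) = (n + 1) ^ n"
    using card_rooted_forests[of "{1..n}" "{0 :: nat}"] unfolding parent_functions_def by simp
  also have "\<dots> = (n + 1) * (n + 1) ^ (n - 1)" using assms by (metis power_eq_if not_one_le_zero)
  finally show ?thesis unfolding mult_cancel1 by simp
qed

section \<open>From parent functions to edge-labelled trees\<close>

lemma parent_functionsE:
  assumes "p \<in> parent_functions n"
  obtains d :: "nat \<Rightarrow> nat" where "\<And>i. i \<in> {1..n} \<Longrightarrow> d (p i) < d i"
    and "\<And>i. i \<in> {1..n} \<Longrightarrow> p i \<in> {0..n}"
proof -
  obtain d :: "nat \<Rightarrow> nat" where "\<forall>i\<in>{1..n}. d (p i) < d i" and p: "p \<in> {1..n} \<rightarrow>\<^sub>E {1..n} \<union> {0}"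
    using assms unfolding parent_functions_def rooted_forests_def by blast
  moreover have "p i \<in> {0..n}" if "i \<in> {1..n}" for i
    using PiE_mem[OF p that] by auto
  ultimately show ?thesis using that by blast
qed

text \<open>Induction outward from the root, well founded by the rank.\<close>

lemma parent_induct [consumes 2, case_names root child]:
  assumes p: "p \<in> parent_functions n" and i: "i \<in> {0..n}"
    and root: "P 0"
    and child: "\<And>i. i \<in> {1..n} \<Longrightarrow> p i \<in> {0..n} \<Longrightarrow> P (p i) \<Longrightarrow> P i"
  shows "P i"
proof -
  obtain d :: "nat \<Rightarrow> nat" where d: "\<And>i. i \<in> {1..n} \<Longrightarrow> d (p i) < d i"
    and r: "\<And>i. i \<in> {1..n} \<Longrightarrow> p i \<in> {0..n}"
    using p by (rule parent_functionsE) blast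
  show ?thesis using i
  proof (induction "d i" arbitrary: i rule: less_induct)
    case less
    show ?case
    proof (cases "i = 0")
      case True
      then show ?thesis using root by simp
    next
      case False
      then have "i \<in> {1..n}" using less.prems by auto
      then show ?thesis using less.hyps[of "p i"] d r child by blast
    qed
  qed
qed

lemma parent_neq:
  assumes "p \<in> parent_functions n" "i \<in> {1..n}"
  shows "p i \<noteq> i"
  using assms by (metis parent_functionsE less_irrefl)

lemma grandparent_neq:
  assumes "p \<in> parent_functions n" "i \<in> {1..n}" "p i \<in> {1..n}"
  shows "p (p i) \<noteq> i"
  using assms by (metis parent_functionsE less_asym)

text \<open>Two labels could share an edge only if each were the parent of the other, which the rank
  forbids.\<close>

lemma inj_on_parent_edge:
  assumes "p \<in> parent_functions n"
  shows "inj_on (\<lambda>i. {i, p i}) {1..n}"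
proof (rule inj_onI)
  fix i j assume "i \<in> {1..n}" "j \<in> {1..n}" "{i, p i} = {j, p j}"
  then show "i = j" using grandparent_neq[OF assms] by (metis doubleton_eq_iff)
qed

text \<open>A vertex of greatest rank on a cycle can be joined to its neighbours there only as their
  child, so both neighbours would be its one parent.\<close>

lemma no_cycle_parent_edges:
  assumes p: "p \<in> parent_functions n"
  shows "\<not> is_cycle ((\<lambda>i. {i, p i}) ` {1..n}) c"
proof
  assume c: "is_cycle ((\<lambda>i. {i, p i}) ` {1..n}) c"
  obtain d :: "nat \<Rightarrow> nat" where d: "\<And>i. i \<in> {1..n} \<Longrightarrow> d (p i) < d i"
    using p by (rule parent_functionsE) blast
  define m where "m = length c"
  have m: "m \<ge> 3" and dist: "distinct c"
    and E: "\<And>i. i < m \<Longrightarrow> {c ! i, c ! (Suc i mod m)} \<in> (\<lambda>i. {i, p i}) ` {1..n}"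
    using c unfolding is_cycle_def m_def by auto
  have "Max (d ` set c) \<in> d ` set c" using m unfolding m_def by (intro Max_in) auto
  then obtain k where k: "k < m" "d (c ! k) = Max (d ` set c)"
    unfolding m_def by (metis imageE in_set_conv_nth)
  have max: "d y \<le> d (c ! k)" if "y \<in> set c" for y using that k by simp
  have up: "y = p (c ! k)" if e: "{c ! k, y} \<in> (\<lambda>i. {i, p i}) ` {1..n}" and y: "y \<in> set c" for y
  proof -
    obtain i where i: "i \<in> {1..n}" "{c ! k, y} = {i, p i}" using e by auto
    then show ?thesis using d[of i] max[OF y] by (auto simp: doubleton_eq_iff)
  qed
  \<comment> \<open>\<open>a\<close> and \<open>b\<close> are the cyclic successor and predecessor
    of \<open>k\<close>; they differ because \<open>m \<ge> 3\<close>.\<close>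
  define a where "a = Suc k mod m"
  define b where "b = (if k = 0 then m - 1 else k - 1)"
  have ab: "a < m" "b < m" "a \<noteq> b" and bk: "Suc b mod m = k"
    using m k unfolding a_def b_def by (auto simp: mod_Suc)
  have "c ! a = p (c ! k)" using up E[of k] k ab unfolding a_def m_def by simp
  moreover have "c ! b = p (c ! k)" using up E[of b] ab bk unfolding m_def
    by (simp add: insert_commute)
  ultimately show False using dist ab unfolding m_def by (metis nth_eq_iff_index_eq)
qed

lemma connected_parent_edges:
  assumes p: "p \<in> parent_functions n"
  shows "connected_graph {0..n} ((\<lambda>i. {i, p i}) ` {1..n})"
proof -
  let ?r = "{(x, y). {x, y} \<in> (\<lambda>i. {i, p i}) ` {1..n}}"
  have sym: "sym (?r\<^sup>*)" by (intro sym_rtrancl) (auto simp: sym_def insert_commute)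
  have "(u, 0) \<in> ?r\<^sup>*" if "u \<in> {0..n}" for u
    using p that
  proof (induction rule: parent_induct)
    case (child i)
    then have "(i, p i) \<in> ?r" by auto
    then show ?case using child by (meson converse_rtrancl_into_rtrancl)
  qed auto
  then have "(u, v) \<in> ?r\<^sup>*" if "u \<in> {0..n}" "v \<in> {0..n}" for u v
    using that sym by (meson rtrancl_trans symD)
  then show ?thesis unfolding connected_graph_def by auto
qed

lemma edge_labelled_parent_tree:
  assumes p: "p \<in> parent_functions n"
  shows "edge_labelled_tree n (parent_tree n p)"
proof -
  have "e \<subseteq> {0..n} \<and> card e = 2" if "e \<in> (\<lambda>i. {i, p i}) ` {1..n}" for e
  proof -
    obtain i where i: "i \<in> {1..n}" "e = {i, p i}" using \<open>e \<in> _\<close> by auto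
    moreover have "p i \<in> {0..n}" using p i by (metis parent_functionsE)
    ultimately show ?thesis using parent_neq[OF p, of i] by auto
  qed
  then have "is_tree {0..n} ((\<lambda>i. {i, p i}) ` {1..n})"
    using connected_parent_edges[OF p] no_cycle_parent_edges[OF p]
    unfolding is_tree_def simple_graph_def by blast
  then show ?thesis
    using inj_on_parent_edge[OF p] unfolding edge_labelled_tree_def parent_tree_def
    by (simp add: inj_on_imp_bij_betw bij_betw_inv_into)
qed

section \<open>Rooting a tree at a vertex and reading off its parent function\<close>

definition represents :: "nat \<Rightarrow> (nat \<Rightarrow> nat) \<Rightarrow> 'v labelled_graph \<Rightarrow> 'v \<Rightarrow> bool" where
  "represents n p = (\<lambda>(V, E, L) r. \<exists>g. bij_betw g {0..n} V \<and> g 0 = r \<and>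
     (\<forall>i\<in>{1..n}. {g i, g (p i)} \<in> E \<and> L {g i, g (p i)} = i))"

text \<open>The isomorphism and the vertex naming \<open>g\<close> are the same map, with root
  \<open>r = g 0\<close>. Although \<open>represents\<close> only asks that parent edges be present,
  they exhaust \<open>E\<close>: labels are injective on \<open>E\<close>, and every label already
  occurs on a parent edge.\<close>

lemma label_iso_parent_tree_iff:
  assumes p: "p \<in> parent_functions n" and T: "edge_labelled_tree n (V, E, L)"
  shows "label_iso (parent_tree n p) (V, E, L) \<longleftrightarrow> (\<exists>r\<in>V. represents n p (V, E, L) r)"
proof
  have pn: "p i \<in> {0..n}" if "i \<in> {1..n}" for i using p that by (metis parent_functionsE)
  have lab: "inv_into {1..n} (\<lambda>i. {i, p i}) {i, p i} = i" if "i \<in> {1..n}" for i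
    using inv_into_f_f[OF inj_on_parent_edge[OF p] that] by simp
  {
    assume "label_iso (parent_tree n p) (V, E, L)"
    then obtain g where g: "bij_betw g {0..n} V"
      and E: "\<forall>u\<in>{0..n}. \<forall>v\<in>{0..n}.
          {u, v} \<in> (\<lambda>i. {i, p i}) ` {1..n} \<longleftrightarrow> {g u, g v} \<in> E"
      and L: "\<forall>e\<in>(\<lambda>i. {i, p i}) ` {1..n}. L (g ` e) = inv_into {1..n} (\<lambda>i. {i, p i}) e"
      unfolding label_iso_def parent_tree_def prod.case by blast
    have "{g i, g (p i)} \<in> E \<and> L {g i, g (p i)} = i" if i: "i \<in> {1..n}" for i
    proof
      show "{g i, g (p i)} \<in> E" using E[rule_format, of i "p i"] imageI[OF i] i pn[OF i] by simp
      show "L {g i, g (p i)} = i" using L i lab[OF i] by auto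
    qed
    moreover have "g 0 \<in> V" using g by (auto simp: bij_betw_def)
    ultimately show "\<exists>r\<in>V. represents n p (V, E, L) r"
      using g unfolding represents_def prod.case by blast
  }
  {
    assume "\<exists>r\<in>V. represents n p (V, E, L) r"
    then obtain g where g: "bij_betw g {0..n} V"
      and E: "\<And>i. i \<in> {1..n} \<Longrightarrow> {g i, g (p i)} \<in> E"
      and L: "\<And>i. i \<in> {1..n} \<Longrightarrow> L {g i, g (p i)} = i"
      unfolding represents_def by auto
    have LE: "bij_betw L E {1..n}" using T unfolding edge_labelled_tree_def by auto
    have "{u, v} \<in> (\<lambda>i. {i, p i}) ` {1..n} \<longleftrightarrow> {g u, g v} \<in> E"
      if uv: "u \<in> {0..n}" "v \<in> {0..n}" for u v
    proof
      assume "{u, v} \<in> (\<lambda>i. {i, p i}) ` {1..n}"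
      then obtain i where i: "i \<in> {1..n}" "{u, v} = {i, p i}" by auto
      have "{g u, g v} = g ` {u, v}" by simp
      also have "\<dots> = {g i, g (p i)}" unfolding i(2) by simp
      finally show "{g u, g v} \<in> E" using E i by simp
    next
      assume e: "{g u, g v} \<in> E"
      define i where "i = L {g u, g v}"
      have i: "i \<in> {1..n}" using LE e unfolding i_def by (auto simp: bij_betw_def)
      have "{g i, g (p i)} = {g u, g v}"
        using LE e E[OF i] L[OF i] unfolding i_def by (metis bij_betw_def inj_onD)
      then have "g ` {i, p i} = g ` {u, v}" by simp
      then have "{i, p i} = {u, v}"
        using g uv i pn[OF i] by (subst (asm) inj_on_image_eq_iff[of g "{0..n}"]) (auto simp: bij_betw_def)
      then show "{u, v} \<in> (\<lambda>i. {i, p i}) ` {1..n}" using i by blast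
    qed
    moreover have "L (g ` e) = inv_into {1..n} (\<lambda>i. {i, p i}) e" if "e \<in> (\<lambda>i. {i, p i}) ` {1..n}" for e
      using that L lab by auto
    ultimately show "label_iso (parent_tree n p) (V, E, L)"
      using g unfolding label_iso_def parent_tree_def prod.case by blast
  }
qed

text \<open>The root and the edge labels force the vertex naming: going outward, one end of the edge
  labelled \<open>i\<close> is already named, so its other end must be \<open>g i\<close>. Equal
  namings then give equal parents.\<close>

lemma represents_unique:
  assumes p: "p \<in> parent_functions n" and p': "p' \<in> parent_functions n"
    and T: "edge_labelled_tree n (V, E, L)"
    and rep: "represents n p (V, E, L) r" and rep': "represents n p' (V, E, L) r"
  shows "p = p'"
proof -
  obtain g where g: "bij_betw g {0..n} V" "g 0 = r"
    and E: "\<And>i. i \<in> {1..n} \<Longrightarrow> {g i, g (p i)} \<in> E \<and> L {g i, g (p i)} = i"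
    using rep unfolding represents_def by auto
  obtain g' where g': "bij_betw g' {0..n} V" "g' 0 = r"
    and E': "\<And>i. i \<in> {1..n} \<Longrightarrow> {g' i, g' (p' i)} \<in> E \<and> L {g' i, g' (p' i)} = i"
    using rep' unfolding represents_def by auto
  have "inj_on L E" using T unfolding edge_labelled_tree_def by (auto simp: bij_betw_def)
  then have edge: "{g i, g (p i)} = {g' i, g' (p' i)}" if "i \<in> {1..n}" for i
    using E[OF that] E'[OF that] by (metis inj_onD)
  have inj: "inj_on g {0..n}" "inj_on g' {0..n}" using g g' by (auto simp: bij_betw_def)
  have eq: "g i = g' i" if "i \<in> {0..n}" for i
    using p that
  proof (induction rule: parent_induct)
    case root
    then show ?case using g g' by simp
  next
    case (child i)
    have "g' i \<noteq> g' (p i)"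
      using child parent_neq[OF p, of i] by (subst inj_on_eq_iff[OF inj(2)]) auto
    then show ?case using edge[OF child(1)] child(3) by (metis doubleton_eq_iff)
  qed
  have "p i = p' i" if i: "i \<in> {1..n}" for i
  proof -
    have "p i \<in> {0..n}" "p' i \<in> {0..n}" using p p' i by (metis parent_functionsE)+
    moreover have "g (p i) = g' (p' i)" using edge[OF i] eq[of i] i by (auto simp: doubleton_eq_iff)
    ultimately show ?thesis using eq inj by (metis inj_onD)
  qed
  moreover have "p \<in> extensional {1..n}" "p' \<in> extensional {1..n}"
    using p p' unfolding parent_functions_def rooted_forests_def by (auto simp: PiE_def)
  ultimately show ?thesis by (intro extensionalityI)
qed

text \<open>In other words, a tree with at least two edges has no nontrivial automorphism
  preserving the edge labels; it fails for the tree with one edge.\<close>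

lemma represents_root_unique:
  assumes n: "n \<ge> 2" and p: "p \<in> parent_functions n"
    and T: "edge_labelled_tree n (V, E, L)"
    and rep: "represents n p (V, E, L) r" and rep': "represents n p (V, E, L) r'"
  shows "r = r'"
proof -
  obtain g where g: "bij_betw g {0..n} V" "g 0 = r"
    and E: "\<And>i. i \<in> {1..n} \<Longrightarrow> {g i, g (p i)} \<in> E \<and> L {g i, g (p i)} = i"
    using rep unfolding represents_def by auto
  obtain g' where g': "bij_betw g' {0..n} V" "g' 0 = r'"
    and E': "\<And>i. i \<in> {1..n} \<Longrightarrow> {g' i, g' (p i)} \<in> E \<and> L {g' i, g' (p i)} = i"
    using rep' unfolding represents_def by auto
  have "inj_on L E" using T unfolding edge_labelled_tree_def by (auto simp: bij_betw_def)
  then have edge: "{g i, g (p i)} = {g' i, g' (p i)}" if "i \<in> {1..n}" for i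
    using E[OF that] E'[OF that] by (metis inj_onD)
  have inj': "inj_on g' {0..n}" using g' by (auto simp: bij_betw_def)
  have pn: "p i \<in> {0..n}" if "i \<in> {1..n}" for i using p that by (metis parent_functionsE)
  show ?thesis
  proof (rule ccontr)
    assume "r \<noteq> r'"
    \<comment> \<open>If the roots differ, no vertex name is fixed: both namings give the edge
      labelled \<open>i\<close> the same two ends, so agreeing at \<open>i\<close> would mean
      agreeing at \<open>p i\<close>.\<close>
    have moved: "g i \<noteq> g' i" if "i \<in> {0..n}" for i
      using p that
    proof (induction rule: parent_induct)
      case root
      then show ?case using g g' \<open>r \<noteq> r'\<close> by simp
    next
      case (child i)
      then show ?case using edge[OF child(1)] by (metis doubleton_eq_iff)
    qed
    have flip: "g i = g' (p i)" "g (p i) = g' i" if "i \<in> {1..n}" for i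
      using edge[OF that] moved[of i] that by (auto simp: doubleton_eq_iff)
    \<comment> \<open>Every edge is now reversed. Two consecutive edges on a path to the root cannot
      both be reversed, so the tree is a star.\<close>
    have root: "p i = 0" if i: "i \<in> {1..n}" for i
    proof (rule ccontr)
      assume "p i \<noteq> 0"
      then have pi: "p i \<in> {1..n}" using pn[OF i] by auto
      then have "g' i = g' (p (p i))" using flip[OF i] flip[OF pi] by simp
      then have "p (p i) = i" using inj' i pn[OF pi] by (auto dest: inj_onD)
      then show False using grandparent_neq[OF p i pi] by simp
    qed
    \<comment> \<open>Reversing two edges of the star sends both leaves to \<open>g 0\<close>; the
      second edge exists because \<open>n \<ge> 2\<close>.\<close>
    have "g' 1 = g' 2" using flip(2)[of 1] flip(2)[of 2] root[of 1] root[of 2] n by simp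
    then show False using inj' n by (auto dest: inj_onD)
  qed
qed

text \<open>\<open>d\<close> is the distance to \<open>r\<close>, and \<open>q v\<close> is the next
  vertex on a shortest path from \<open>v\<close> to \<open>r\<close>.\<close>

lemma connected_graph_distance:
  assumes conn: "connected_graph V E" and r: "r \<in> V" and sub: "\<And>e. e \<in> E \<Longrightarrow> e \<subseteq> V"
  obtains d :: "'v \<Rightarrow> nat" and q where
    "\<And>v. v \<in> V - {r} \<Longrightarrow> q v \<in> V \<and> {v, q v} \<in> E \<and> d (q v) < d v"
proof -
  define R where "R = {(x, y). {x, y} \<in> E}"
  define d where "d v = (LEAST k. (v, r) \<in> R ^^ k)" for v
  have "\<exists>w. w \<in> V \<and> {v, w} \<in> E \<and> d w < d v" if v: "v \<in> V - {r}" for v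
  proof -
    have "(v, r) \<in> R\<^sup>*" using conn r v unfolding connected_graph_def R_def by auto
    then have "\<exists>k. (v, r) \<in> R ^^ k" by (simp add: rtrancl_power)
    then have dv: "(v, r) \<in> R ^^ d v" unfolding d_def by (rule LeastI_ex)
    then obtain k where k: "d v = Suc k" using v by (cases "d v") auto
    then obtain w where w: "(v, w) \<in> R" "(w, r) \<in> R ^^ k"
      using dv by (metis relpow_Suc_E2)
    then have "d w \<le> k" unfolding d_def by (intro Least_le)
    moreover have "{v, w} \<in> E" using w unfolding R_def by simp
    ultimately show ?thesis using k sub[of "{v, w}"] by auto
  qed
  then have "\<forall>v\<in>V - {r}. \<exists>w. w \<in> V \<and> {v, w} \<in> E \<and> d w < d v" by blast
  then obtain q where "\<forall>v\<in>V - {r}. q v \<in> V \<and> {v, q v} \<in> E \<and> d (q v) < d v"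
    using bchoice by metis
  then show ?thesis using that by blast
qed

text \<open>Every vertex other than the root takes the label of the edge to its parent. There are as many
  such vertices as edges, so an injection suffices and acyclicity of the graph is not used.\<close>

lemma represents_exists:
  assumes T: "edge_labelled_tree n (V, E, L)" and r: "r \<in> V"
  shows "\<exists>p\<in>parent_functions n. represents n p (V, E, L) r"
proof -
  have tree: "is_tree V E" and cardV: "card V = n + 1" and L: "bij_betw L E {1..n}"
    using T unfolding edge_labelled_tree_def by auto
  have finV: "finite V" using cardV card.infinite by fastforce
  have cardE: "card E = n" using bij_betw_same_card[OF L] by simp
  have finE: "finite E" using L bij_betw_finite by blast
  obtain d :: "'a \<Rightarrow> nat" and q where
    q: "\<And>v. v \<in> V - {r} \<Longrightarrow> q v \<in> V \<and> {v, q v} \<in> E \<and> d (q v) < d v"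
    using tree r connected_graph_distance[of V E r]
    unfolding is_tree_def simple_graph_def by metis
  \<comment> \<open>Distinct vertices sharing an edge would be each other's parents, against the
    decrease of \<open>d\<close>.\<close>
  have inj: "inj_on (\<lambda>v. {v, q v}) (V - {r})"
  proof (rule inj_onI)
    fix v w assume vw: "v \<in> V - {r}" "w \<in> V - {r}" "{v, q v} = {w, q w}"
    then show "v = w" using q[of v] q[of w] by (auto simp: doubleton_eq_iff)
  qed
  have sub: "(\<lambda>v. {v, q v}) ` (V - {r}) \<subseteq> E" using q by auto
  moreover have "card ((\<lambda>v. {v, q v}) ` (V - {r})) = card E"
    using card_image[OF inj] cardE cardV r finV by simp
  ultimately have "bij_betw (\<lambda>v. {v, q v}) (V - {r}) E"
    using inj finE by (simp add: bij_betw_def card_subset_eq)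
  then have lam: "bij_betw (L \<circ> (\<lambda>v. {v, q v})) (V - {r}) {1..n}"
    using L by (rule bij_betw_trans)
  \<comment> \<open>\<open>h\<close> gives each vertex its name in \<open>{0..n}\<close>; its
    inverse \<open>g\<close> is the naming required by \<open>represents\<close>.\<close>
  define h where "h v = (if v = r then 0 else L {v, q v})" for v
  have h: "bij_betw h V {0..n}"
  proof -
    have "bij_betw h (V - {r}) {1..n}"
      using lam by (rule bij_betw_cong[THEN iffD1, rotated]) (auto simp: h_def)
    then have "bij_betw h (insert r (V - {r})) (insert 0 {1..n})"
      using notIn_Un_bij_betw[of r "V - {r}" h "{1..n}"] by (auto simp: h_def)
    moreover have "insert r (V - {r}) = V" "insert 0 {1..n} = {0..n}" using r by auto
    ultimately show ?thesis by simp
  qed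
  define g where "g = inv_into V h"
  have g: "bij_betw g {0..n} V" unfolding g_def using h by (rule bij_betw_inv_into)
  have gh: "g (h v) = v" if "v \<in> V" for v
    unfolding g_def using h that by (rule bij_betw_inv_into_left)
  have hg: "h (g i) = i" if "i \<in> {0..n}" for i
    unfolding g_def using h that by (rule bij_betw_inv_into_right)
  have g0: "g 0 = r" using gh[OF r] by (simp add: h_def)
  have gi: "g i \<in> V - {r}" if i: "i \<in> {1..n}" for i
  proof -
    have "g i \<in> V" using g i by (auto simp: bij_betw_def)
    moreover have "g i \<noteq> r" using hg[of i] i by (auto simp: h_def)
    ultimately show ?thesis by simp
  qed
  \<comment> \<open>This is \<open>q\<close> transported to names, restricted because
    \<open>rooted_forests\<close> consists of extensional functions.\<close>
  define p where "p = (\<lambda>i\<in>{1..n}. h (q (g i)))"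
  have gp: "g (p i) = q (g i)" if i: "i \<in> {1..n}" for i
    using gh q[OF gi[OF i]] i by (simp add: p_def)
  have "p \<in> {1..n} \<rightarrow>\<^sub>E {1..n} \<union> {0}"
  proof (rule PiE_I)
    fix i assume i: "i \<in> {1..n}"
    have "h (q (g i)) \<in> {0..n}" using h q[OF gi[OF i]] by (auto simp: bij_betw_def)
    then show "p i \<in> {1..n} \<union> {0}" using i by (auto simp: p_def)
  qed (auto simp: p_def)
  moreover have "\<forall>i\<in>{1..n}. (d \<circ> g) (p i) < (d \<circ> g) i" using gp q gi by simp
  ultimately have "p \<in> parent_functions n"
    unfolding parent_functions_def rooted_forests_def by blast
  moreover have "{g i, g (p i)} \<in> E \<and> L {g i, g (p i)} = i" if i: "i \<in> {1..n}" for i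
  proof -
    have "L {g i, q (g i)} = h (g i)" using gi[OF i] by (simp add: h_def)
    then show ?thesis using gp[OF i] q[OF gi[OF i]] hg[of i] i by simp
  qed
  ultimately show ?thesis using g g0 unfolding represents_def by blast
qed

section \<open>Counting isomorphism classes\<close>

lemma card_parent_functions_iso:
  assumes n: "n \<ge> 2" and T: "edge_labelled_tree n T"
  shows "card {p \<in> parent_functions n. label_iso (parent_tree n p) T} = n + 1"
proof -
  obtain V E L where VEL: "T = (V, E, L)" by (cases T)
  note T' = T[unfolded VEL]
  \<comment> \<open>\<open>P\<close> is a bijection from the \<open>n + 1\<close> possible roots:
    injective because a parent function determines its root when \<open>n \<ge> 2\<close>, onto
    because a root determines its parent function.\<close>
  define P where "P r = (SOME p. p \<in> parent_functions n \<and> represents n p T r)" for r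
  have P: "P r \<in> parent_functions n" "represents n (P r) T r" if "r \<in> V" for r
    using someI_ex[of "\<lambda>p. p \<in> parent_functions n \<and> represents n p T r"]
      represents_exists[OF T' that] unfolding P_def VEL by blast+
  have "inj_on P V"
    using P represents_root_unique[OF n _ T'] unfolding VEL by (metis inj_onI)
  moreover have "P ` V = {p \<in> parent_functions n. label_iso (parent_tree n p) T}"
  proof
    show "P ` V \<subseteq> {p \<in> parent_functions n. label_iso (parent_tree n p) T}"
      using P label_iso_parent_tree_iff[OF _ T'] unfolding VEL by blast
    show "{p \<in> parent_functions n. label_iso (parent_tree n p) T} \<subseteq> P ` V"
    proof safe
      fix p assume p: "p \<in> parent_functions n" "label_iso (parent_tree n p) T"
      then obtain r where r: "r \<in> V" "represents n p T r"
        using label_iso_parent_tree_iff[OF _ T'] unfolding VEL by blast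
      then have "p = P r" using represents_unique[OF p(1) P(1) T'] P unfolding VEL by blast
      then show "p \<in> P ` V" using r by blast
    qed
  qed
  ultimately have "card {p \<in> parent_functions n. label_iso (parent_tree n p) T} = card V"
    by (metis card_image)
  then show ?thesis using T' by (simp add: edge_labelled_tree_def)
qed

text \<open>The parent functions are partitioned by the isomorphism class of their trees, and every
  class receives exactly \<open>n + 1\<close> of them.\<close>

lemma UT_mult:
  assumes n: "n \<ge> 2"
  shows "(n + 1) * UT n = card (parent_functions n)"
proof -
  define C where "C = {T :: nat labelled_graph. edge_labelled_tree n T} // label_iso_rel n"
  define F where "F X = {p \<in> parent_functions n. parent_tree n p \<in> X}" for X
  have F: "card (F X) = n + 1" if X: "X \<in> C" for X
  proof -
    obtain T where T: "edge_labelled_tree n T" "X = label_iso_rel n `` {T}"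
      using X unfolding C_def by (auto elim: quotientE)
    have "parent_tree n p \<in> X \<longleftrightarrow> label_iso (parent_tree n p) T" if "p \<in> parent_functions n" for p
      using T edge_labelled_parent_tree[OF that] label_iso_sym
      unfolding label_iso_rel_def by blast
    then have "F X = {p \<in> parent_functions n. label_iso (parent_tree n p) T}"
      unfolding F_def by auto
    then show ?thesis using card_parent_functions_iso[OF n T(1)] by simp
  qed
  have U: "(\<Union>X\<in>C. F X) = parent_functions n"
  proof -
    have "\<exists>X\<in>C. parent_tree n p \<in> X" if "p \<in> parent_functions n" for p
      using edge_labelled_parent_tree[OF that] Union_quotient[OF equiv_label_iso_rel[of n]]
      unfolding C_def by blast
    then show ?thesis unfolding F_def by auto
  qed
  have disj: "F X \<inter> F Y = {}" if "X \<in> C" "Y \<in> C" "X \<noteq> Y" for X Y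
    using quotient_disj[OF equiv_label_iso_rel[of n]] that unfolding C_def F_def by blast
  \<comment> \<open>The fibres are nonempty and disjoint, so the classes embed into a finite power
    set. Finiteness of \<open>C\<close> is not immediate, as there are infinitely many trees on
    natural numbers.\<close>
  have "inj_on F C"
  proof (rule inj_onI)
    fix X Y assume XY: "X \<in> C" "Y \<in> C" "F X = F Y"
    then show "X = Y" using F[of X] disj[of X Y] by fastforce
  qed
  moreover have "F ` C \<subseteq> Pow (parent_functions n)" unfolding F_def by auto
  ultimately have finC: "finite C"
    using finite_parent_functions by (meson finite_Pow_iff finite_imageD finite_subset)
  have "card (\<Union>X\<in>C. F X) = (\<Sum>X\<in>C. card (F X))"
    using finC disj finite_parent_functions by (intro card_UN_disjoint) (auto simp: F_def)
  then show ?thesis using F U unfolding UT_def C_def[symmetric] by simp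
qed

theorem theorem2:
  fixes n :: nat
  assumes "n \<ge> 2"
  shows "eq_parking n = UT n"
proof -
  have "(n + 1) * eq_parking n = (n + 1) * UT n"
    using assms eq_parking_mult UT_mult card_parent_functions[of n] by simp
  then show ?thesis unfolding mult_cancel1 by simp
qed

end
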